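(* For every positive integer $n$, the symmetric quartic form $$4p_1^4-5p_2p_1^2-\tfrac{139}{20}p_3p_1+4p_2^2+4p_4\in\mathbb{R}[X_1,\dots,X_n]$$ is nonnegative on $\mathbb{R}^n$. Moreover, for every $n\ge 4$ this form is not a sum of squares of polynomials in $\mathbb{R}[X_1,\dots,X_n]$.
   Context: $p_k=p_k(X_1,\dots,X_n)=X_1^k+\cdots+X_n^k$. *)

theory Defs
  imports Complex_Main "HOL-Library.Poly_Mapping" "HOL-Library.FuncSet"
begin

text \<open>
  Real polynomials in the variables \<open>X i\<close> (\<open>i :: nat\<close>) are finitely supported maps from
  exponent vectors to coefficients; the ring structure is the convolution product of
  \<^theory>\<open>HOL-Library.Poly_Mapping\<close>.
\<close>

type_synonym rpoly = "(nat \<Rightarrow>\<^sub>0 nat) \<Rightarrow>\<^sub>0 real"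

definition X :: "nat \<Rightarrow> rpoly" where
  "X i = Poly_Mapping.single (Poly_Mapping.single i 1) 1"

definition Const :: "real \<Rightarrow> rpoly" where
  "Const c = Poly_Mapping.single 0 c"

text \<open>The subring of polynomials involving only \<open>X 1, \<dots>, X n\<close>.\<close>

definition polys :: "nat \<Rightarrow> rpoly set" where
  "polys n = {f. \<forall>m \<in> Poly_Mapping.keys f. Poly_Mapping.keys m \<subseteq> {1..n}}"

definition eval_poly :: "(nat \<Rightarrow> real) \<Rightarrow> rpoly \<Rightarrow> real" where
  "eval_poly x f = (\<Sum>m \<in> Poly_Mapping.keys f. Poly_Mapping.lookup f m *
     (\<Prod>i \<in> Poly_Mapping.keys m. x i ^ Poly_Mapping.lookup m i))"

definition power_sum :: "nat \<Rightarrow> nat \<Rightarrow> rpoly" where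
  "power_sum n k = (\<Sum>i = 1..n. X i ^ k)"

definition quartic :: "nat \<Rightarrow> rpoly" where
  "quartic n =
     (let p = power_sum n in
      4 * p 1 ^ 4 - 5 * p 2 * p 1 ^ 2 - Const (139 / 20) * p 3 * p 1 + 4 * p 2 ^ 2 + 4 * p 4)"

text \<open>Points of real \<open>n\<close>-space are the extensional functions on \<open>{1..n}\<close>.\<close>

definition nonneg_on_space :: "nat \<Rightarrow> rpoly \<Rightarrow> bool" where
  "nonneg_on_space n f \<longleftrightarrow> (\<forall>x \<in> {1..n} \<rightarrow>\<^sub>E (UNIV :: real set). 0 \<le> eval_poly x f)"

definition sum_of_squares :: "nat \<Rightarrow> rpoly \<Rightarrow> bool" where
  "sum_of_squares n f \<longleftrightarrow> (\<exists>qs. set qs \<subseteq> polys n \<and> f = (\<Sum>q \<leftarrow> qs. q ^ 2))"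

end

theory Submission
  imports Defs "HOL-Computational_Algebra.Polynomial"
begin

text \<open>
  Nonnegativity. Scale to \<open>p\<^sub>1 = 1\<close> and put \<open>t = p\<^sub>2\<close>, \<open>c = 4 t + 4 / t - 5 \<ge> 3\<close>. The form becomes
  \<open>\<Sum>i. x\<^sub>i\<^sup>2 (4 x\<^sub>i\<^sup>2 - 139/20 x\<^sub>i + c)\<close>. The bracket is negative only if \<open>t\<close> is close to \<open>1\<close> and
  \<open>4/5 < x\<^sub>i < 15/16\<close>. Then all other coordinates are at most about \<open>0.66\<close>, and since their
  squares sum to \<open>t - x\<^sub>i\<^sup>2\<close>, which is bounded away from \<open>0\<close>, they outweigh the small negative term.

  Not a sum of squares. If the form equals \<open>\<Sum>q\<^sup>2\<close>, each \<open>t \<mapsto> q (t x)\<close> is a univariate polynomial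
  whose square is at most a constant times \<open>t\<^sup>4\<close>, hence a multiple of \<open>t\<^sup>2\<close>; so every \<open>q\<close> acts as a quadratic
  form. A signed combination of point evaluations, supported on the first four coordinates,
  is nonnegative on squares of quadratic forms but negative on the given quartic.
\<close>

subsection \<open>Nonnegativity\<close>

text \<open>The parabola \<open>4 y^2 - 139/20 y\<close> has its vertex at \<open>139 / 160\<close>
  and decreases to the left of it, so on \<open>y <= b\<close> its minimum is at
  \<open>b\<close>.\<close>

lemma bracket_nonneg_of_small:
  fixes y :: real
  assumes "c \<ge> 3" "y \<le> b" "b \<le> 139 / 160"
  shows "4 * y\<^sup>2 - 139 / 20 * y + c \<ge> 4 * b\<^sup>2 - 139 / 20 * b + 3"
proof -
  have "(b - y) * (139 / 20 - 4 * (b + y)) \<ge> 0"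
    using assms by (intro mult_nonneg_nonneg) auto
  then have "4 * b\<^sup>2 - 139 / 20 * b \<le> 4 * y\<^sup>2 - 139 / 20 * y"
    by (simp add: algebra_simps power2_eq_square diff_divide_distrib)
  then show ?thesis using assms(1) by linarith
qed

lemma quartic_nonneg_normalized:
  fixes y :: "'a \<Rightarrow> real"
  assumes fin: "finite S" and sum1: "(\<Sum>i\<in>S. y i) = 1"
  shows "0 \<le> 4 - 5 * (\<Sum>i\<in>S. y i ^ 2) - 139 / 20 * (\<Sum>i\<in>S. y i ^ 3)
    + 4 * (\<Sum>i\<in>S. y i ^ 2) ^ 2 + 4 * (\<Sum>i\<in>S. y i ^ 4)" (is "0 \<le> ?F")
proof -
  define t where "t = (\<Sum>i\<in>S. y i ^ 2)"
  define c where "c = 4 * t + 4 / t - 5"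
  define h where "h = (\<lambda>z. 4 * z\<^sup>2 - 139 / 20 * z + c)"
  have "t \<noteq> 0"
  proof
    assume "t = 0"
    then have "\<forall>i\<in>S. y i = 0"
      using fin by (simp add: t_def sum_nonneg_eq_0_iff)
    with sum1 show False by simp
  qed
  moreover have "t \<ge> 0" by (simp add: t_def sum_nonneg)
  ultimately have tpos: "t > 0" by simp
  have ct: "c * t = 4 * t\<^sup>2 + 4 - 5 * t"
    using tpos by (simp add: c_def field_simps power2_eq_square)
  have c3: "c \<ge> 3"
  proof -
    have "c * t \<ge> 3 * t" using zero_le_power2[of "t - 1"]
      unfolding ct by (simp add: power2_diff)
    then show ?thesis using tpos by simp
  qed
  have F: "?F = (\<Sum>i\<in>S. (y i)\<^sup>2 * h (y i))"
  proof -
    have "(\<Sum>i\<in>S. (y i)\<^sup>2 * h (y i))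
        = (\<Sum>i\<in>S. 4 * y i ^ 4 - 139 / 20 * y i ^ 3 + c * y i ^ 2)"
      by (intro sum.cong) (auto simp: h_def algebra_simps eval_nat_numeral)
    also have "\<dots> = 4 * (\<Sum>i\<in>S. y i ^ 4) - 139 / 20 * (\<Sum>i\<in>S. y i ^ 3) + c * t"
      by (simp add: sum.distrib sum_subtractf sum_distrib_left t_def)
    finally show ?thesis unfolding t_def[symmetric] using ct by simp
  qed
  show ?thesis
  proof (cases "\<forall>i\<in>S. h (y i) \<ge> 0")
    case True
    then show ?thesis unfolding F by (intro sum_nonneg) auto
  next
    case False
    then obtain k where k: "k \<in> S" "h (y k) < 0" by force
    define a where "a = y k"
    define r where "r = t - a\<^sup>2"
    have h0: "4 * a\<^sup>2 - 139 / 20 * a + c < 0" using k by (simp add: a_def h_def)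
    \<comment> \<open>\<open>4/5\<close> and \<open>15/16\<close> are the roots of
      \<open>4 z^2 - 139/20 z + 3\<close>. As \<open>c >= 3\<close>, a negative bracket forces
      \<open>a\<close> strictly between them.\<close>
    have a1: "a > 4 / 5"
    proof (rule ccontr)
      assume "\<not> ?thesis"
      then have "(4 - 5 * a) * (15 - 16 * a) \<ge> 0" by (intro mult_nonneg_nonneg) auto
      with h0 c3 show False by (simp add: algebra_simps power2_eq_square)
    qed
    have a2: "a < 15 / 16"
    proof (rule ccontr)
      assume "\<not> ?thesis"
      then have "(5 * a - 4) * (16 * a - 15) \<ge> 0" by (intro mult_nonneg_nonneg) auto
      with h0 c3 show False by (simp add: algebra_simps power2_eq_square)
    qed
    \<comment> \<open>The minimum, at \<open>139/160\<close>, is \<open>-121/6400\<close>, about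
      \<open>-0.0189\<close>.\<close>
    have hlow: "4 * a\<^sup>2 - 139 / 20 * a + 3 \<ge> - 19 / 1000"
      using zero_le_power2[of "160 * a - 139"] by (simp add: power2_diff power_mult_distrib)
    with h0 have "c < 3019 / 1000" by simp
    then have "c * t < 3019 / 1000 * t" using tpos by simp
    then have tq: "4 * (t - 1)\<^sup>2 < 19 / 1000 * t"
      unfolding ct by (simp add: power2_diff)
    \<comment> \<open>\<open>tq\<close> confines \<open>t\<close> between roots near
      \<open>0.933\<close> and \<open>1.071\<close>; the bounds \<open>0.927\<close> and
      \<open>1.073\<close> round these outwards. In both arguments the second factor makes the
      product agree with a multiple of the quadratic in \<open>tq\<close> up to small linear terms,
      so that a linear contradiction remains.\<close>
    have t1: "t < 1073 / 1000"
    proof (rule ccontr)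
      assume "\<not> ?thesis"
      then have "(1000 * t - 1073) * (1000 * t - 932) \<ge> 0" by (intro mult_nonneg_nonneg) auto
      with tq tpos \<open>\<not> ?thesis\<close> show False by (simp add: power2_eq_square algebra_simps)
    qed
    have t2: "t > 927 / 1000"
    proof (rule ccontr)
      assume "\<not> ?thesis"
      then have "(927 - 1000 * t) * (1078 - 1000 * t) \<ge> 0" by (intro mult_nonneg_nonneg) auto
      with tq tpos \<open>\<not> ?thesis\<close> show False by (simp add: power2_eq_square algebra_simps)
    qed
    have asq: "a\<^sup>2 > 16 / 25" "a\<^sup>2 < 225 / 256"
      using power_strict_mono[OF a1, of 2] power_strict_mono[OF a2, of 2] a1
      by (simp_all add: power2_eq_square)
    have rest: "r = (\<Sum>i\<in>S - {k}. (y i)\<^sup>2)"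
      using k(1) fin by (simp add: r_def t_def a_def sum.remove)
    have le_r: "(y i)\<^sup>2 \<le> r" if "i \<in> S - {k}" for i
      unfolding rest using that fin by (intro member_le_sum) auto
    have r1: "r < 433 / 1000" using t1 asq by (simp add: r_def)
    have r2: "r > 48 / 1000" using t2 asq by (simp add: r_def)
    \<comment> \<open>The target \<open>17/1000\<close> exceeds \<open>225/256 * 19/1000\<close>,
      the largest possible loss at \<open>k\<close>. A small \<open>r\<close> keeps the other
      coordinates small and their brackets large; a large \<open>r\<close> compensates for a weaker
      bound on the brackets.\<close>
    have "\<exists>\<kappa>. \<kappa> * r \<ge> 17 / 1000 \<and> (\<forall>i\<in>S - {k}. h (y i) \<ge> \<kappa>)"
    proof (cases "r \<le> 1 / 4")
      case True
      have "h (y i) \<ge> 21 / 40" if "i \<in> S - {k}" for i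
      proof -
        have "(y i)\<^sup>2 \<le> (1 / 2)\<^sup>2" using le_r[OF that] True by (simp add: power2_eq_square)
        then have "y i \<le> 1 / 2" by (rule power2_le_imp_le) simp
        from bracket_nonneg_of_small[OF c3 this] show ?thesis
          by (simp add: h_def power2_eq_square)
      qed
      then show ?thesis using r2 by (intro exI[of _ "21 / 40"]) auto
    next
      case False
      have "h (y i) \<ge> 3 / 20" if "i \<in> S - {k}" for i
      proof -
        have "(y i)\<^sup>2 \<le> (659 / 1000)\<^sup>2" using le_r[OF that] r1 by (simp add: power2_eq_square)
        then have "y i \<le> 659 / 1000" by (rule power2_le_imp_le) simp
        from bracket_nonneg_of_small[OF c3 this] show ?thesis
          by (simp add: h_def power2_eq_square)
      qed
      then show ?thesis using False by (intro exI[of _ "3 / 20"]) auto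
    qed
    then obtain \<kappa> where \<kappa>: "\<kappa> * r \<ge> 17 / 1000" "\<And>i. i \<in> S - {k} \<Longrightarrow> h (y i) \<ge> \<kappa>"
      by blast
    have "(\<Sum>i\<in>S - {k}. (y i)\<^sup>2 * h (y i)) \<ge> (\<Sum>i\<in>S - {k}. (y i)\<^sup>2 * \<kappa>)"
      by (intro sum_mono mult_left_mono \<kappa>) auto
    also have "(\<Sum>i\<in>S - {k}. (y i)\<^sup>2 * \<kappa>) = \<kappa> * r"
      by (simp add: rest sum_distrib_left mult.commute)
    finally have "(\<Sum>i\<in>S - {k}. (y i)\<^sup>2 * h (y i)) \<ge> 17 / 1000"
      using \<kappa>(1) by linarith
    moreover have "a\<^sup>2 * h a \<ge> - 17 / 1000"
    proof -
      have "h a \<ge> - 19 / 1000" using hlow c3 by (simp add: h_def)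
      then have "a\<^sup>2 * h a \<ge> a\<^sup>2 * (- 19 / 1000)" by (intro mult_left_mono) auto
      then show ?thesis using asq by linarith
    qed
    ultimately show ?thesis
      unfolding F using k(1) fin by (simp add: sum.remove a_def)
  qed
qed

text \<open>By homogeneity of degree 4 the coordinates may be divided by their sum. If the sum
  vanishes, only \<open>4 p_2^2 + 4 p_4\<close> survives.\<close>

lemma quartic_nonneg:
  fixes x :: "'a \<Rightarrow> real"
  assumes fin: "finite S"
  shows "0 \<le> 4 * (\<Sum>i\<in>S. x i) ^ 4 - 5 * (\<Sum>i\<in>S. x i ^ 2) * (\<Sum>i\<in>S. x i) ^ 2
     - 139 / 20 * (\<Sum>i\<in>S. x i ^ 3) * (\<Sum>i\<in>S. x i)
     + 4 * (\<Sum>i\<in>S. x i ^ 2) ^ 2 + 4 * (\<Sum>i\<in>S. x i ^ 4)"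
proof (cases "(\<Sum>i\<in>S. x i) = 0")
  case True
  then show ?thesis by (simp add: sum_nonneg)
next
  case False
  define s where "s = (\<Sum>i\<in>S. x i)"
  define y where "y i = x i / s" for i
  have s: "s \<noteq> 0" using False by (simp add: s_def)
  have P: "(\<Sum>i\<in>S. x i ^ j) = s ^ j * (\<Sum>i\<in>S. y i ^ j)" for j
    using s by (simp add: y_def sum_distrib_left power_divide)
  have "(\<Sum>i\<in>S. y i) = 1"
    using s by (simp add: y_def sum_divide_distrib[symmetric] s_def[symmetric])
  from quartic_nonneg_normalized[OF fin this]
  have "0 \<le> s ^ 4 * (4 - 5 * (\<Sum>i\<in>S. y i ^ 2) - 139 / 20 * (\<Sum>i\<in>S. y i ^ 3)
    + 4 * (\<Sum>i\<in>S. y i ^ 2) ^ 2 + 4 * (\<Sum>i\<in>S. y i ^ 4))"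
    by (intro mult_nonneg_nonneg) auto
  then show ?thesis
    unfolding s_def[symmetric] P
    by (simp add: algebra_simps power_mult_distrib eval_nat_numeral)
qed

subsection \<open>Evaluation of polynomials\<close>

definition monom_eval :: "(nat \<Rightarrow> real) \<Rightarrow> (nat \<Rightarrow>\<^sub>0 nat) \<Rightarrow> real" where
  "monom_eval x m = (\<Prod>i \<in> Poly_Mapping.keys m. x i ^ Poly_Mapping.lookup m i)"

lemma monom_eval_superset:
  assumes "finite S" "Poly_Mapping.keys m \<subseteq> S"
  shows "monom_eval x m = (\<Prod>i \<in> S. x i ^ Poly_Mapping.lookup m i)"
  unfolding monom_eval_def
  using assms by (intro prod.mono_neutral_left) (auto simp: in_keys_iff)

lemma monom_eval_add: "monom_eval x (m + m') = monom_eval x m * monom_eval x m'"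
proof -
  let ?S = "Poly_Mapping.keys m \<union> Poly_Mapping.keys m'"
  have "Poly_Mapping.keys (m + m') \<subseteq> ?S" by (rule Poly_Mapping.keys_add)
  then show ?thesis
    by (simp add: monom_eval_superset[of ?S] lookup_add power_add prod.distrib)
qed

lemma eval_poly_superset:
  assumes "finite S" "Poly_Mapping.keys f \<subseteq> S"
  shows "eval_poly x f = (\<Sum>m \<in> S. Poly_Mapping.lookup f m * monom_eval x m)"
  unfolding eval_poly_def monom_eval_def[symmetric]
  using assms by (intro sum.mono_neutral_left) (auto simp: in_keys_iff)

lemma eval_poly_add: "eval_poly x (f + g) = eval_poly x f + eval_poly x g"
proof -
  let ?S = "Poly_Mapping.keys f \<union> Poly_Mapping.keys g"
  have "Poly_Mapping.keys (f + g) \<subseteq> ?S" by (rule Poly_Mapping.keys_add)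
  then show ?thesis
    by (simp add: eval_poly_superset[of ?S] lookup_add distrib_right sum.distrib)
qed

lemma eval_poly_0 [simp]: "eval_poly x 0 = 0"
  by (simp add: eval_poly_def)

lemma eval_poly_single [simp]:
  "eval_poly x (Poly_Mapping.single m c) = c * monom_eval x m"
  by (subst eval_poly_superset[of "{m}"]) (auto simp: lookup_single)

lemma eval_poly_1 [simp]: "eval_poly x 1 = 1"
  unfolding single_one[symmetric] by (simp add: monom_eval_def del: single_one)

lemma eval_poly_uminus: "eval_poly x (- f) = - eval_poly x f"
  using eval_poly_add[of x f "- f"] by simp

lemma eval_poly_diff: "eval_poly x (f - g) = eval_poly x f - eval_poly x g"
  using eval_poly_add[of x f "- g"] by (simp add: eval_poly_uminus)

lemma eval_poly_sum: "eval_poly x (\<Sum>a\<in>S. F a) = (\<Sum>a\<in>S. eval_poly x (F a))"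
  by (induction S rule: infinite_finite_induct) (auto simp: eval_poly_add)

lemma eval_poly_sum_list: "eval_poly x (\<Sum>a\<leftarrow>l. F a) = (\<Sum>a\<leftarrow>l. eval_poly x (F a))"
  by (induction l) (auto simp: eval_poly_add)

lemma rpoly_sum_single:
  fixes f :: rpoly
  shows "f = (\<Sum>m \<in> Poly_Mapping.keys f. Poly_Mapping.single m (Poly_Mapping.lookup f m))"
  by (rule poly_mapping_eqI)
     (auto simp: lookup_sum lookup_single when_def in_keys_iff sum.delta)

lemma eval_poly_mult: "eval_poly x (f * g) = eval_poly x f * eval_poly x g"
proof -
  have "f * g = (\<Sum>m \<in> Poly_Mapping.keys f. \<Sum>m' \<in> Poly_Mapping.keys g.
      Poly_Mapping.single (m + m') (Poly_Mapping.lookup f m * Poly_Mapping.lookup g m'))"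
    by (subst rpoly_sum_single[of f], subst rpoly_sum_single[of g])
       (simp add: sum_product mult_single)
  then show ?thesis
    by (simp add: eval_poly_sum eval_poly_def[of x f] eval_poly_def[of x g]
        monom_eval_def[symmetric] sum_product monom_eval_add mult_ac)
qed

lemma eval_poly_power: "eval_poly x (f ^ k) = eval_poly x f ^ k"
  by (induction k) (auto simp: eval_poly_mult)

lemma eval_poly_numeral: "eval_poly x (numeral k) = numeral k"
proof -
  have "eval_poly x (of_nat j) = of_nat j" for j
    by (induction j) (auto simp: eval_poly_add)
  from this[of "numeral k"] show ?thesis by simp
qed

lemma eval_poly_Const: "eval_poly x (Const c) = c"
  by (simp add: Const_def monom_eval_def)

lemma eval_poly_X: "eval_poly x (X i) = x i"
  by (simp add: X_def monom_eval_def)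

lemma eval_poly_power_sum: "eval_poly x (power_sum n k) = (\<Sum>i = 1..n. x i ^ k)"
  by (simp add: power_sum_def eval_poly_sum eval_poly_power eval_poly_X)

lemmas eval_poly_simps = eval_poly_add eval_poly_diff eval_poly_mult eval_poly_power
  eval_poly_numeral eval_poly_Const eval_poly_power_sum

lemma eval_quartic:
  "eval_poly x (quartic n) =
     4 * (\<Sum>i = 1..n. x i) ^ 4 - 5 * (\<Sum>i = 1..n. x i ^ 2) * (\<Sum>i = 1..n. x i) ^ 2
     - 139 / 20 * (\<Sum>i = 1..n. x i ^ 3) * (\<Sum>i = 1..n. x i)
     + 4 * (\<Sum>i = 1..n. x i ^ 2) ^ 2 + 4 * (\<Sum>i = 1..n. x i ^ 4)"
  by (simp add: quartic_def Let_def eval_poly_simps)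

subsection \<open>Polynomials of quadratic growth\<close>

lemma bounded_poly_degree_0:
  fixes p :: "real poly"
  assumes "\<And>t. \<bar>poly p t\<bar> \<le> C"
  shows "degree p = 0"
proof (rule ccontr)
  assume "degree p \<noteq> 0"
  then have "filterlim (poly p) at_infinity at_infinity"
    by (intro filterlim_poly_at_infinity) simp
  then have "filterlim (\<lambda>t. norm (poly p t)) at_top at_infinity"
    by (rule filterlim_at_infinity_imp_norm_at_top)
  then have "eventually (\<lambda>t. norm (poly p t) \<ge> C + 1) at_infinity"
    by (simp add: filterlim_at_top)
  then obtain t where "norm (poly p t) \<ge> C + 1"
    by (metis eventually_at_infinity order_refl real_norm_def abs_ge_self)
  with assms[of t] show False by simp
qed

lemma poly_nonpos_at_0:
  fixes r :: "real poly"
  assumes "\<And>t. t \<noteq> 0 \<Longrightarrow> poly r t \<le> 0"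
  shows "poly r 0 \<le> 0"
proof (rule tendsto_upperbound)
  show "(poly r \<longlongrightarrow> poly r 0) (at 0)"
    using poly_isCont isCont_def by blast
  show "eventually (\<lambda>t. poly r t \<le> 0) (at 0)"
    using assms by (simp add: eventually_at_filter)
qed simp

text \<open>Each induction step removes one factor \<open>t\<close>: the bound at \<open>0\<close>
  kills the constant term, and dividing by \<open>t^2\<close> lowers \<open>k\<close>. At
  \<open>k = 0\<close> a bounded polynomial is left, which is constant. Thus terms both below and
  above degree \<open>k\<close> are excluded.\<close>

lemma square_le_power_imp_monom:
  fixes p :: "real poly"
  assumes "\<And>t. (poly p t)\<^sup>2 \<le> C * t ^ (2 * k)"
  shows "p = monom (coeff p k) k"
  using assms
proof (induction k arbitrary: p)
  case 0
  then have "(poly p t)\<^sup>2 \<le> C" for t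
    by (metis mult_zero_right power_0 mult.right_neutral)
  then have "degree p = 0"
    by (intro bounded_poly_degree_0[of p "sqrt C"]) (metis real_le_rsqrt power2_abs)
  then show ?case
    by (metis degree_eq_zeroE coeff_pCons_0 monom_0)
next
  case (Suc k)
  obtain a q where p: "p = pCons a q" by (metis pCons_cases)
  have "(poly p 0)\<^sup>2 \<le> 0" using Suc.prems[of 0] by simp
  then have a: "a = 0" by (simp add: p)
  have nz: "(poly q t)\<^sup>2 \<le> C * t ^ (2 * k)" if "t \<noteq> 0" for t
  proof -
    have "t\<^sup>2 * (poly q t)\<^sup>2 \<le> t\<^sup>2 * (C * t ^ (2 * k))"
      using Suc.prems[of t] by (simp add: p a power_mult_distrib power2_eq_square algebra_simps)
    then show ?thesis using that by simp
  qed
  \<comment> \<open>Dividing by \<open>t^2\<close> lost the point \<open>0\<close>; continuity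
    recovers it.\<close>
  have "poly (q\<^sup>2 - monom C (2 * k)) 0 \<le> 0"
    by (rule poly_nonpos_at_0) (use nz in \<open>simp add: poly_monom\<close>)
  then have "(poly q t)\<^sup>2 \<le> C * t ^ (2 * k)" for t
    using nz by (cases "t = 0") (auto simp: poly_monom)
  then have "q = monom (coeff q k) k" by (rule Suc.IH)
  then show ?case by (simp add: p a monom_Suc)
qed

section \<open>Homogeneous parts and quadratic forms\<close>

definition monom_degree :: "(nat \<Rightarrow>\<^sub>0 nat) \<Rightarrow> nat" where
  "monom_degree m = (\<Sum>i \<in> Poly_Mapping.keys m. Poly_Mapping.lookup m i)"

lemma monom_eval_scale:
  "monom_eval (\<lambda>i. t * x i) m = t ^ monom_degree m * monom_eval x m"
  by (simp add: monom_eval_def monom_degree_def power_mult_distrib prod.distrib power_sum)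

lemma monom_degree_SucE:
  assumes "monom_degree m = Suc k"
  obtains i m' where "m = Poly_Mapping.single i 1 + m'" "monom_degree m' = k"
    "i \<in> Poly_Mapping.keys m" "Poly_Mapping.keys m' \<subseteq> Poly_Mapping.keys m"
proof -
  have "Poly_Mapping.keys m \<noteq> {}"
    using assms by (auto simp: monom_degree_def)
  then obtain i where i: "i \<in> Poly_Mapping.keys m" by blast
  define m' where "m' = m - Poly_Mapping.single i 1"
  have m: "m = Poly_Mapping.single i 1 + m'"
    using i unfolding m'_def
    by (intro poly_mapping_eqI) (auto simp: lookup_add lookup_minus lookup_single when_def in_keys_iff)
  have lk: "Poly_Mapping.lookup m j = (if j = i then 1 else 0) + Poly_Mapping.lookup m' j" for j
    by (subst m) (simp add: lookup_add lookup_single when_def)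
  have sub: "Poly_Mapping.keys m' \<subseteq> Poly_Mapping.keys m"
    by (auto simp: in_keys_iff lk)
  have "monom_degree m' = (\<Sum>j \<in> Poly_Mapping.keys m. Poly_Mapping.lookup m' j)"
    unfolding monom_degree_def using sub by (intro sum.mono_neutral_left) (auto simp: in_keys_iff)
  moreover have "monom_degree m = 1 + (\<Sum>j \<in> Poly_Mapping.keys m. Poly_Mapping.lookup m' j)"
    unfolding monom_degree_def using i by (simp add: lk sum.distrib)
  ultimately have "monom_degree m' = k" using assms by simp
  with m i sub that show ?thesis by blast
qed

lemma monom_eval_degree_2:
  assumes "monom_degree m = 2"
  obtains i j where "i \<in> Poly_Mapping.keys m" "j \<in> Poly_Mapping.keys m"
    "\<And>x. monom_eval x m = x i * x j"
proof -
  obtain i m1 where 1: "m = Poly_Mapping.single i 1 + m1" "monom_degree m1 = 1"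
    "i \<in> Poly_Mapping.keys m" "Poly_Mapping.keys m1 \<subseteq> Poly_Mapping.keys m"
    using assms monom_degree_SucE[of m 1] by (auto simp: numeral_2_eq_2)
  obtain j m2 where 2: "m1 = Poly_Mapping.single j 1 + m2" "monom_degree m2 = 0"
    "j \<in> Poly_Mapping.keys m1"
    using 1(2) monom_degree_SucE[of m1 0] by (metis One_nat_def)
  have "monom_eval x m2 = 1" for x
    using 2(2) by (auto simp: monom_degree_def monom_eval_def in_keys_iff intro!: prod.neutral)
  then have "monom_eval x m = x i * x j" for x
    unfolding 1(1) 2(1) monom_eval_add by (simp add: monom_eval_def)
  with 1 2 that show ?thesis by blast
qed

text \<open>Along the line \<open>t * x\<close> the polynomial \<open>q\<close> becomes univariate,
  with the degree-\<open>k\<close> part of \<open>q\<close> at \<open>x\<close> as its coefficient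
  of \<open>t^k\<close>. The growth bound leaves only that term, and \<open>t = 1\<close> gives the
  claim. The point \<open>x\<close> is fixed, so \<open>C\<close> may depend on it.\<close>

lemma eval_poly_eq_homogeneous_part:
  assumes "\<And>t. (eval_poly (\<lambda>i. t * x i) q)\<^sup>2 \<le> C * t ^ (2 * k)"
  shows "eval_poly x q =
    (\<Sum>m \<in> {m \<in> Poly_Mapping.keys q. monom_degree m = k}. Poly_Mapping.lookup q m * monom_eval x m)"
proof -
  define p where "p = (\<Sum>m \<in> Poly_Mapping.keys q.
    monom (Poly_Mapping.lookup q m * monom_eval x m) (monom_degree m))"
  have p: "poly p t = eval_poly (\<lambda>i. t * x i) q" for t
    by (simp add: p_def poly_sum poly_monom eval_poly_def monom_eval_def[symmetric]
        monom_eval_scale mult_ac)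
  have "p = monom (coeff p k) k"
    by (rule square_le_power_imp_monom[of _ C]) (use assms p in simp)
  then have "poly p 1 = coeff p k"
    by (metis poly_monom power_one mult.right_neutral)
  also have "coeff p k = (\<Sum>m \<in> Poly_Mapping.keys q.
      if monom_degree m = k then Poly_Mapping.lookup q m * monom_eval x m else 0)"
    by (simp add: p_def coeff_sum)
  finally show ?thesis
    by (simp add: p sum.inter_filter)
qed

text \<open>No symmetry is imposed on \<open>A\<close>, so a single entry can encode a monomial
  \<open>c * x i * x j\<close>.\<close>

definition quad_form :: "nat \<Rightarrow> (nat \<Rightarrow> nat \<Rightarrow> real) \<Rightarrow> (nat \<Rightarrow> real) \<Rightarrow> real" where
  "quad_form n A x = (\<Sum>i = 1..n. \<Sum>j = 1..n. A i j * (x i * x j))"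

lemma quad_form_sum_ex:
  assumes "finite M" "\<And>m. m \<in> M \<Longrightarrow> \<exists>A. \<forall>x. F m x = quad_form n A x"
  shows "\<exists>A. \<forall>x. (\<Sum>m\<in>M. F m x) = quad_form n A x"
  using assms
proof (induction M rule: finite_induct)
  case empty
  show ?case by (rule exI[of _ "\<lambda>_ _. 0"]) (simp add: quad_form_def)
next
  case (insert m M)
  then obtain A B where "\<forall>x. F m x = quad_form n A x" "\<forall>x. (\<Sum>m\<in>M. F m x) = quad_form n B x"
    by blast
  with insert show ?case
    by (intro exI[of _ "\<lambda>i j. A i j + B i j"])
       (simp add: quad_form_def distrib_right sum.distrib)
qed

lemma quad_form_monom:
  assumes "i \<in> {1..n}" "j \<in> {1..n}"
  shows "quad_form n (\<lambda>i' j'. if i' = i \<and> j' = j then c else 0) x = c * (x i * x j)"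
proof -
  have "quad_form n (\<lambda>i' j'. if i' = i \<and> j' = j then c else 0) x
    = (\<Sum>i' = 1..n. if i' = i then (\<Sum>j' = 1..n. if j' = j then c * (x i * x j) else 0) else 0)"
    unfolding quad_form_def
    by (rule sum.cong[OF refl]) (simp add: if_distrib[of "\<lambda>z. z * _"] cong: if_cong)
  then show ?thesis using assms by simp
qed

lemma eval_poly_quad_form_ex:
  assumes "q \<in> polys n" "\<And>x t. (eval_poly (\<lambda>i. t * x i) q)\<^sup>2 \<le> C x * t ^ 4"
  shows "\<exists>A. \<forall>x. eval_poly x q = quad_form n A x"
proof -
  let ?M = "{m \<in> Poly_Mapping.keys q. monom_degree m = 2}"
  have "\<exists>A. \<forall>x. Poly_Mapping.lookup q m * monom_eval x m = quad_form n A x" if m: "m \<in> ?M" for m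
  proof -
    obtain i j where ij: "i \<in> Poly_Mapping.keys m" "j \<in> Poly_Mapping.keys m"
      "\<And>x. monom_eval x m = x i * x j"
      using m monom_eval_degree_2 by blast
    have "Poly_Mapping.keys m \<subseteq> {1..n}" using assms(1) m by (simp add: polys_def)
    with ij(1,2) have "i \<in> {1..n}" "j \<in> {1..n}" by blast+
    from quad_form_monom[OF this, of "Poly_Mapping.lookup q m"] show ?thesis
      unfolding ij(3) by metis
  qed
  then have "\<exists>A. \<forall>x. (\<Sum>m\<in>?M. Poly_Mapping.lookup q m * monom_eval x m) = quad_form n A x"
    by (intro quad_form_sum_ex) auto
  moreover have "eval_poly x q = (\<Sum>m\<in>?M. Poly_Mapping.lookup q m * monom_eval x m)" for x
    using assms(2) by (intro eval_poly_eq_homogeneous_part[of _ _ "C x"]) simp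
  ultimately show ?thesis by simp
qed

subsection \<open>A separating functional\<close>

text \<open>Padding by zeros lets the same test points serve every \<open>n >= 4\<close>, which
  reduces the obstruction to four variables.\<close>

definition pt :: "real \<Rightarrow> real \<Rightarrow> real \<Rightarrow> real \<Rightarrow> nat \<Rightarrow> real" where
  "pt a b c d i =
     (if i = 1 then a else if i = 2 then b else if i = 3 then c else if i = 4 then d else 0)"

lemma sum_supported_first_four:
  fixes F :: "nat \<Rightarrow> real"
  assumes "n \<ge> 4" "\<And>i. i \<notin> {1, 2, 3, 4} \<Longrightarrow> F i = 0"
  shows "(\<Sum>i = 1..n. F i) = F 1 + F 2 + F 3 + F 4"
proof -
  have "(\<Sum>i = 1..n. F i) = sum F {1, 2, 3, 4}"
    using assms by (intro sum.mono_neutral_right) auto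
  then show ?thesis by simp
qed

lemma power_sum_pt:
  assumes "n \<ge> 4" "k > 0"
  shows "(\<Sum>i = 1..n. pt a b c d i ^ k) = a ^ k + b ^ k + c ^ k + d ^ k"
  using assms by (subst sum_supported_first_four) (auto simp: pt_def)

lemma eval_quartic_pt:
  assumes "n \<ge> 4"
  shows "eval_poly (pt a b c d) (quartic n) =
    4 * (a + b + c + d) ^ 4 - 5 * (a\<^sup>2 + b\<^sup>2 + c\<^sup>2 + d\<^sup>2) * (a + b + c + d)\<^sup>2
    - 139 / 20 * (a ^ 3 + b ^ 3 + c ^ 3 + d ^ 3) * (a + b + c + d)
    + 4 * (a\<^sup>2 + b\<^sup>2 + c\<^sup>2 + d\<^sup>2)\<^sup>2 + 4 * (a ^ 4 + b ^ 4 + c ^ 4 + d ^ 4)"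
  using power_sum_pt[OF assms, of 1 a b c d]
  by (simp add: eval_quartic power_sum_pt[OF assms] del: One_nat_def)

lemma quad_form_pt:
  assumes "n \<ge> 4"
  shows "quad_form n A (pt a b c d) =
    A 1 1 * a\<^sup>2 + A 2 2 * b\<^sup>2 + A 3 3 * c\<^sup>2 + A 4 4 * d\<^sup>2
    + (A 1 2 + A 2 1) * (a * b) + (A 1 3 + A 3 1) * (a * c) + (A 1 4 + A 4 1) * (a * d)
    + (A 2 3 + A 3 2) * (b * c) + (A 2 4 + A 4 2) * (b * d) + (A 3 4 + A 4 3) * (c * d)"
proof -
  have "quad_form n A (pt a b c d) = (\<Sum>i = 1..n. A i 1 * (pt a b c d i * a)
      + A i 2 * (pt a b c d i * b) + A i 3 * (pt a b c d i * c) + A i 4 * (pt a b c d i * d))"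
    unfolding quad_form_def
    by (intro sum.cong refl, subst sum_supported_first_four[OF assms]) (auto simp: pt_def)
  also have "\<dots> = A 1 1 * a\<^sup>2 + A 2 2 * b\<^sup>2 + A 3 3 * c\<^sup>2 + A 4 4 * d\<^sup>2
    + (A 1 2 + A 2 1) * (a * b) + (A 1 3 + A 3 1) * (a * c) + (A 1 4 + A 4 1) * (a * d)
    + (A 2 3 + A 3 2) * (b * c) + (A 2 4 + A 4 2) * (b * d) + (A 3 4 + A 4 3) * (c * d)"
    by (subst sum_supported_first_four[OF assms]) (auto simp: pt_def algebra_simps power2_eq_square)
  finally show ?thesis .
qed

text \<open>
  Averaging over coordinate permutations reduces the search to \<open>S\<^sub>4\<close>-invariant functionals \<open>L\<close>. This
  one takes the values \<open>314\<close>, \<open>12\<close>, \<open>26\<close>, \<open>-12\<close>, \<open>22\<close> on \<open>x\<^sub>1\<^sup>4\<close>, \<open>x\<^sub>1\<^sup>3x\<^sub>2\<close>, \<open>x\<^sub>1\<^sup>2x\<^sub>2\<^sup>2\<close>, \<open>x\<^sub>1\<^sup>2x\<^sub>2x\<^sub>3\<close>, \<open>x\<^sub>1x\<^sub>2x\<^sub>3x\<^sub>4\<close>.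
  The quadratic form \<open>q \<mapsto> L (q\<^sup>2)\<close> splits along the isotypic components of the quadratic forms
  under \<open>S\<^sub>4\<close>; the three groups of squares in \<open>separating_quad_form_square\<close> are these blocks.
\<close>

definition separating :: "((nat \<Rightarrow> real) \<Rightarrow> real) \<Rightarrow> real" where
  "separating g =
     178 * (g (pt 1 0 0 0) + g (pt 0 1 0 0) + g (pt 0 0 1 0) + g (pt 0 0 0 1))
   + 65 * (g (pt 1 1 0 0) + g (pt 1 0 1 0) + g (pt 1 0 0 1)
         + g (pt 0 1 1 0) + g (pt 0 1 0 1) + g (pt 0 0 1 1))
   + 7 * (g (pt 1 (-1) 0 0) + g (pt 1 0 (-1) 0) + g (pt 1 0 0 (-1))
         + g (pt 0 1 (-1) 0) + g (pt 0 1 0 (-1)) + g (pt 0 0 1 (-1)))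
   - 34 * (g (pt 1 1 1 0) + g (pt 1 1 0 1) + g (pt 1 0 1 1) + g (pt 0 1 1 1))
   + 22 * g (pt 1 1 1 1)"

lemma separating_add: "separating (\<lambda>x. g x + h x) = separating g + separating h"
  by (simp add: separating_def)

lemma separating_sum_list:
  "separating (\<lambda>x. \<Sum>q\<leftarrow>qs. G q x) = (\<Sum>q\<leftarrow>qs. separating (G q))"
  by (induction qs) (simp_all add: separating_add, simp add: separating_def)

lemma separating_quartic:
  "n \<ge> 4 \<Longrightarrow> separating (\<lambda>x. eval_poly x (quartic n)) = - 2"
  by (simp add: separating_def eval_quartic_pt)

text \<open>The weight \<open>-34\<close> rules out an argument point by point; an explicit identity
  with nonnegative coefficients is used instead.\<close>

lemma separating_quad_form_square:
  assumes "n \<ge> 4"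
  shows "separating (\<lambda>x. (quad_form n A x)\<^sup>2) \<ge> 0"
proof -
  \<comment> \<open>At the test points the form depends on \<open>A\<close> only through its ten
    coefficients as a quadratic form in four variables.\<close>
  define a1 a2 a3 a4 where a: "a1 = A 1 1" "a2 = A 2 2" "a3 = A 3 3" "a4 = A 4 4"
  define b12 b13 b14 b23 b24 b34 where b: "b12 = A 1 2 + A 2 1" "b13 = A 1 3 + A 3 1"
    "b14 = A 1 4 + A 4 1" "b23 = A 2 3 + A 3 2" "b24 = A 2 4 + A 4 2" "b34 = A 3 4 + A 4 3"
  have "separating (\<lambda>x. (quad_form n A x)\<^sup>2) =
      98 * (a1 + a2 + a3 + a4)\<^sup>2
    + 2 * ((6 * (a1 + a2 - a3 - a4) + (b12 - b34))\<^sup>2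
         + (6 * (a1 - a2 + a3 - a4) + (b13 - b24))\<^sup>2
         + (6 * (a1 - a2 - a3 + a4) + (b14 - b23))\<^sup>2)
    + 12 * ((b12 + b34 - b13 - b24)\<^sup>2 + (b12 + b34 - b14 - b23)\<^sup>2 + (b13 + b24 - b14 - b23)\<^sup>2)"
    unfolding separating_def quad_form_pt[OF assms] a[symmetric] b[symmetric]
    by (simp only: power_one power_zero_numeral power2_minus mult_zero_left mult_zero_right
        mult_1_right mult_1_left add_0_left add_0_right minus_mult_minus mult_minus_right mult_minus_left) algebra
  then show ?thesis by simp
qed

lemma eval_quartic_scale:
  "eval_poly (\<lambda>i. t * x i) (quartic n) = t ^ 4 * eval_poly x (quartic n)"
  by (simp add: eval_quartic power_mult_distrib sum_distrib_left[symmetric])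
     (simp add: algebra_simps eval_nat_numeral)

lemma quartic_not_sum_of_squares:
  assumes n: "n \<ge> 4"
  shows "\<not> sum_of_squares n (quartic n)"
proof
  assume "sum_of_squares n (quartic n)"
  then obtain qs where qs: "set qs \<subseteq> polys n" "quartic n = (\<Sum>q\<leftarrow>qs. q\<^sup>2)"
    by (auto simp: sum_of_squares_def)
  have ev: "eval_poly x (quartic n) = (\<Sum>q\<leftarrow>qs. (eval_poly x q)\<^sup>2)" for x
    by (simp add: qs(2) eval_poly_sum_list eval_poly_power)
  have "separating (\<lambda>x. (eval_poly x q)\<^sup>2) \<ge> 0" if q: "q \<in> set qs" for q
  proof -
    have "(eval_poly x q)\<^sup>2 \<le> eval_poly x (quartic n)" for x
      unfolding ev using q by (intro member_le_sum_list) auto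
    \<comment> \<open>Domination of each square by the whole sum, applied along a line through the
      origin, becomes the quartic growth bound, with a constant depending on
      \<open>x\<close>.\<close>
    from this[of "\<lambda>i. t * x i" for t x]
    have "(eval_poly (\<lambda>i. t * x i) q)\<^sup>2 \<le> eval_poly x (quartic n) * t ^ 4" for x t
      by (simp add: eval_quartic_scale mult.commute)
    then obtain A where "\<forall>x. eval_poly x q = quad_form n A x"
      using eval_poly_quad_form_ex[of q n "\<lambda>x. eval_poly x (quartic n)"] qs(1) q by blast
    then show ?thesis using separating_quad_form_square[OF n, of A] by simp
  qed
  then have "(\<Sum>q\<leftarrow>qs. separating (\<lambda>x. (eval_poly x q)\<^sup>2)) \<ge> 0"
    by (intro sum_list_nonneg) auto
  moreover have "(\<Sum>q\<leftarrow>qs. separating (\<lambda>x. (eval_poly x q)\<^sup>2)) = - 2"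
    using separating_quartic[OF n] by (simp add: ev separating_sum_list)
  ultimately show False by simp
qed

theorem theorem3p6:
  shows "(\<forall>n\<ge>1. nonneg_on_space n (quartic n)) \<and>
         (\<forall>n\<ge>4. \<not> sum_of_squares n (quartic n))"
  unfolding nonneg_on_space_def eval_quartic
  using quartic_nonneg[OF finite_atLeastAtMost] quartic_not_sum_of_squares by blast

end
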